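(* Let $R$ be a ring. (1) Suppose there exist a not necessarily unitary ring $\mathfrak{m}$, a field $\kappa$, and maps $\lambda,\rho$ (both preserving $1$) defining a semidirect product such that $R=\mathfrak{m}\rtimes_{\lambda,\rho}\kappa$. Identify $\mathfrak{m}$ with $\{(x,0) : x\in\mathfrak{m}\}\subseteq R$ and $\kappa$ with $\{(0,u): u\in\kappa\}\subseteq R$. Then $\mathfrak{m}\in\mathrm{Max}(R)$, $\kappa$ is a subfield of $R$, and $R/\mathfrak{m}\cong\kappa$ in such a way that the composite ring homomorphism $R/\mathfrak{m}\cong\kappa\subseteq R$ is a section of the canonical projection $R\to R/\mathfrak{m}$; in particular $R$ satisfies property $(\star)$. (2) If $R$ satisfies property $(\star)$, exhibited by $\mathfrak{m}\in\mathrm{Max}(R)$ and a field $\kappa\subseteq R$, then $R\cong\mathfrak{m}\rtimes\kappa$ as rings, where $\mathfrak{m}\rtimes\kappa$ is the semidirect product in which $\lambda$ and $\rho$ act by multiplication in $R$, i.e. $\lambda(u)(x)=ux$ and $\rho(u)(x)=xu$ for $u\in\kappa$, $x\in\mathfrak{m}$. In other words, property $(\star)$ is equivalent to the ring being (isomorphic to) a semidirect product of a not necessarily unitary ring and a field, and one can always restrict to semidirect products with $\lambda$ and $\rho$ given by multiplication in $R$.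
   Context: Conventions: rings are associative and unitary (not necessarily commutative) unless stated otherwise, ring homomorphisms preserve $1$, ideals are two-sided, and subrings and subfields share the same $1$. Fields are commutative. $\mathrm{Max}(R)$ is the set of maximal ideals of $R$. Property $(\star)$ for a ring $R$: there exists a maximal ideal $\mathfrak{m}$ of $R$ such that the canonical projection $\pi\colon R\to R/\mathfrak{m}$ has a section (a ring homomorphism $s\colon R/\mathfrak m\to R$ with $\pi\circ s=\mathrm{id}$), so that $R/\mathfrak{m}$ is isomorphic to a field $\kappa$ contained in $R$. One says that $\mathfrak{m}\in\mathrm{Max}(R)$ and a field $\kappa\subseteq R$ exhibit property $(\star)$ for $R$ if there is a ring isomorphism $j\colon R/\mathfrak{m}\to\kappa$ such that the composite $R/\mathfrak{m}\xrightarrow{j}\kappa\subseteq R$ is a section of $\pi$. Semidirect product: let $B,S$ be associative, not necessarily unitary rings. Let $\lambda\colon S\to\mathrm{End}(B_B)$ be a ring homomorphism (endomorphisms of $B$ as a right $B$-module: additive maps $f$ with $f(xy)=f(x)y$) and $\rho\colon S\to\mathrm{End}({}_BB)$ a ring anti-homomorphism (endomorphisms of $B$ as a left $B$-module: additive maps $f$ with $f(xy)=xf(y)$) such that for all $s,t\in S$, $x,y\in B$: $\lambda(s)\circ\rho(t)=\rho(t)\circ\lambda(s)$ and $\rho(s)(x)\cdot y=x\cdot\lambda(s)(y)$. Then $B\rtimes_{\lambda,\rho}S$ is the not necessarily unitary ring with additive group $B\oplus S$ and product $(b,s)\cdot(c,t)=(bc+\lambda(s)(c)+\rho(t)(b),\,st)$.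 Whenever $S$ has a $1$, it is assumed that $\lambda$ and $\rho$ preserve $1$, so that $B\rtimes_{\lambda,\rho}S$ is unitary with $1=(0,1)$ and contains a copy $\{(0,s)\}$ of $S$. *)

theory Defs
  imports "HOL-Algebra.Subrings"
begin

section \<open>Not necessarily unitary rings\<close>

text \<open>These are carried by the library's ring records. The field \<open>one\<close> of the record is
  unconstrained and is to be ignored.\<close>

locale nonunital_ring = abelian_group R for R (structure) +
  assumes m_closed: "\<lbrakk>x \<in> carrier R; y \<in> carrier R\<rbrakk> \<Longrightarrow> x \<otimes> y \<in> carrier R"
    and m_assoc: "\<lbrakk>x \<in> carrier R; y \<in> carrier R; z \<in> carrier R\<rbrakk>
      \<Longrightarrow> (x \<otimes> y) \<otimes> z = x \<otimes> (y \<otimes> z)"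
    and l_distr: "\<lbrakk>x \<in> carrier R; y \<in> carrier R; z \<in> carrier R\<rbrakk>
      \<Longrightarrow> (x \<oplus> y) \<otimes> z = x \<otimes> z \<oplus> y \<otimes> z"
    and r_distr: "\<lbrakk>x \<in> carrier R; y \<in> carrier R; z \<in> carrier R\<rbrakk>
      \<Longrightarrow> z \<otimes> (x \<oplus> y) = z \<otimes> x \<oplus> z \<otimes> y"

definition nonunital_hom :: "('a, 'm) ring_scheme \<Rightarrow> ('b, 'n) ring_scheme \<Rightarrow> ('a \<Rightarrow> 'b) set" where
  "nonunital_hom R S = {h. h \<in> carrier R \<rightarrow> carrier S \<and>
     (\<forall>x \<in> carrier R. \<forall>y \<in> carrier R.
        h (x \<otimes>\<^bsub>R\<^esub> y) = h x \<otimes>\<^bsub>S\<^esub> h y \<and> h (x \<oplus>\<^bsub>R\<^esub> y) = h x \<oplus>\<^bsub>S\<^esub> h y)}"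

definition nonunital_antihom :: "('a, 'm) ring_scheme \<Rightarrow> ('b, 'n) ring_scheme \<Rightarrow> ('a \<Rightarrow> 'b) set" where
  "nonunital_antihom R S = {h. h \<in> carrier R \<rightarrow> carrier S \<and>
     (\<forall>x \<in> carrier R. \<forall>y \<in> carrier R.
        h (x \<otimes>\<^bsub>R\<^esub> y) = h y \<otimes>\<^bsub>S\<^esub> h x \<and> h (x \<oplus>\<^bsub>R\<^esub> y) = h x \<oplus>\<^bsub>S\<^esub> h y)}"

section \<open>Endomorphism rings of a ring as a one-sided module over itself\<close>

text \<open>Endomorphisms are extensional functions (undefined outside the carrier), so that
  equality in the endomorphism rings is equality on the carrier.\<close>

definition additive_end :: "('b, 'm) ring_scheme \<Rightarrow> ('b \<Rightarrow> 'b) set" where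
  "additive_end B = {f \<in> carrier B \<rightarrow>\<^sub>E carrier B.
     \<forall>x \<in> carrier B. \<forall>y \<in> carrier B. f (x \<oplus>\<^bsub>B\<^esub> y) = f x \<oplus>\<^bsub>B\<^esub> f y}"

definition end_ring_on :: "('b, 'm) ring_scheme \<Rightarrow> ('b \<Rightarrow> 'b) set \<Rightarrow> ('b \<Rightarrow> 'b) ring" where
  "end_ring_on B E =
     \<lparr>carrier = E,
      mult = compose (carrier B),
      one = (\<lambda>x \<in> carrier B. x),
      zero = (\<lambda>x \<in> carrier B. \<zero>\<^bsub>B\<^esub>),
      add = (\<lambda>f g. \<lambda>x \<in> carrier B. f x \<oplus>\<^bsub>B\<^esub> g x)\<rparr>"

definition right_module_End :: "('b, 'm) ring_scheme \<Rightarrow> ('b \<Rightarrow> 'b) ring" where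
  "right_module_End B = end_ring_on B {f \<in> additive_end B.
     \<forall>x \<in> carrier B. \<forall>y \<in> carrier B. f (x \<otimes>\<^bsub>B\<^esub> y) = f x \<otimes>\<^bsub>B\<^esub> y}"

definition left_module_End :: "('b, 'm) ring_scheme \<Rightarrow> ('b \<Rightarrow> 'b) ring" where
  "left_module_End B = end_ring_on B {f \<in> additive_end B.
     \<forall>x \<in> carrier B. \<forall>y \<in> carrier B. f (x \<otimes>\<^bsub>B\<^esub> y) = x \<otimes>\<^bsub>B\<^esub> f y}"

section \<open>Semidirect products\<close>

locale semidirect_data = B: nonunital_ring B + S: nonunital_ring S
  for B :: "('b, 'm) ring_scheme" and S :: "('s, 'n) ring_scheme" +
  fixes lam rho :: "'s \<Rightarrow> 'b \<Rightarrow> 'b"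
  assumes lam_hom: "lam \<in> nonunital_hom S (right_module_End B)"
    and rho_antihom: "rho \<in> nonunital_antihom S (left_module_End B)"
    and lam_rho_commute: "\<lbrakk>s \<in> carrier S; t \<in> carrier S; x \<in> carrier B\<rbrakk>
      \<Longrightarrow> lam s (rho t x) = rho t (lam s x)"
    and rho_lam_balanced: "\<lbrakk>s \<in> carrier S; x \<in> carrier B; y \<in> carrier B\<rbrakk>
      \<Longrightarrow> rho s x \<otimes>\<^bsub>B\<^esub> y = x \<otimes>\<^bsub>B\<^esub> lam s y"

locale unital_semidirect_data = semidirect_data B S lam rho + S: ring S
  for B :: "('b, 'm) ring_scheme" and S :: "('s, 'n) ring_scheme"
    and lam rho :: "'s \<Rightarrow> 'b \<Rightarrow> 'b" +
  assumes lam_one: "lam \<one>\<^bsub>S\<^esub> = \<one>\<^bsub>right_module_End B\<^esub>"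
    and rho_one: "rho \<one>\<^bsub>S\<^esub> = \<one>\<^bsub>left_module_End B\<^esub>"

text \<open>The field \<open>one\<close> is only meaningful for unital data.\<close>

definition semidirect_product ::
  "('b, 'm) ring_scheme \<Rightarrow> ('s, 'n) ring_scheme \<Rightarrow> ('s \<Rightarrow> 'b \<Rightarrow> 'b) \<Rightarrow> ('s \<Rightarrow> 'b \<Rightarrow> 'b)
    \<Rightarrow> ('b \<times> 's) ring" where
  "semidirect_product B S lam rho =
     \<lparr>carrier = carrier B \<times> carrier S,
      mult = (\<lambda>(b, s) (c, t). (b \<otimes>\<^bsub>B\<^esub> c \<oplus>\<^bsub>B\<^esub> lam s c \<oplus>\<^bsub>B\<^esub> rho t b, s \<otimes>\<^bsub>S\<^esub> t)),
      one = (\<zero>\<^bsub>B\<^esub>, \<one>\<^bsub>S\<^esub>),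
      zero = (\<zero>\<^bsub>B\<^esub>, \<zero>\<^bsub>S\<^esub>),
      add = (\<lambda>(b, s) (c, t). (b \<oplus>\<^bsub>B\<^esub> c, s \<oplus>\<^bsub>S\<^esub> t))\<rparr>"

definition left_mult :: "('r, 'm) ring_scheme \<Rightarrow> 'r set \<Rightarrow> 'r \<Rightarrow> 'r \<Rightarrow> 'r" where
  "left_mult R \<mm> u = (\<lambda>x \<in> \<mm>. u \<otimes>\<^bsub>R\<^esub> x)"

definition right_mult :: "('r, 'm) ring_scheme \<Rightarrow> 'r set \<Rightarrow> 'r \<Rightarrow> 'r \<Rightarrow> 'r" where
  "right_mult R \<mm> u = (\<lambda>x \<in> \<mm>. x \<otimes>\<^bsub>R\<^esub> u)"

section \<open>Property (\<open>\<star>\<close>)\<close>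

definition is_section :: "('r, 'm) ring_scheme \<Rightarrow> 'r set \<Rightarrow> ('r set \<Rightarrow> 'r) \<Rightarrow> bool" where
  "is_section R \<mm> s \<longleftrightarrow> s \<in> ring_hom (R Quot \<mm>) R \<and>
     (\<forall>X \<in> carrier (R Quot \<mm>). \<mm> +>\<^bsub>R\<^esub> s X = X)"

text \<open>For noncommutative \<open>R\<close> the quotient by a maximal two-sided ideal need not be a field, so
  the requirement that it be isomorphic to a subfield does not follow from the section.\<close>

definition property_star :: "('r, 'm) ring_scheme \<Rightarrow> bool" where
  "property_star R \<longleftrightarrow> (\<exists>\<mm>. maximalideal \<mm> R \<and> (\<exists>s. is_section R \<mm> s) \<and>
     (\<exists>\<kappa>. subfield \<kappa> R \<and> R Quot \<mm> \<simeq> R\<lparr>carrier := \<kappa>\<rparr>))"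

definition exhibits_star :: "('r, 'm) ring_scheme \<Rightarrow> 'r set \<Rightarrow> 'r set \<Rightarrow> bool" where
  "exhibits_star R \<mm> \<kappa> \<longleftrightarrow> maximalideal \<mm> R \<and> subfield \<kappa> R \<and>
     (\<exists>j \<in> ring_iso (R Quot \<mm>) (R\<lparr>carrier := \<kappa>\<rparr>). is_section R \<mm> j)"

section \<open>The canonical copies of the factors\<close>

context nonunital_ring
begin

lemma l_zero_mult: "x \<in> carrier R \<Longrightarrow> \<zero> \<otimes> x = \<zero>"
  using l_distr[of \<zero> \<zero> x] m_closed[of \<zero> x] by (simp add: add.l_cancel_one)

lemma r_zero_mult: "x \<in> carrier R \<Longrightarrow> x \<otimes> \<zero> = \<zero>"
  using r_distr[of \<zero> \<zero> x] m_closed[of x \<zero>] by (simp add: add.l_cancel_one)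

lemma additive_end_zero: "f \<in> additive_end R \<Longrightarrow> f \<zero> = \<zero>"
proof -
  assume f: "f \<in> additive_end R"
  then have "f \<zero> \<in> carrier R" by (auto simp: additive_end_def)
  moreover have "f (\<zero> \<oplus> \<zero>) = f \<zero> \<oplus> f \<zero>"
    using f zero_closed unfolding additive_end_def by blast
  ultimately show ?thesis by (simp add: add.l_cancel_one)
qed

end

context semidirect_data
begin

lemma lam_closed: "\<lbrakk>s \<in> carrier S; x \<in> carrier B\<rbrakk> \<Longrightarrow> lam s x \<in> carrier B"
  using lam_hom
  by (auto simp: nonunital_hom_def right_module_End_def end_ring_on_def additive_end_def Pi_iff PiE_iff)

lemma rho_closed: "\<lbrakk>s \<in> carrier S; x \<in> carrier B\<rbrakk> \<Longrightarrow> rho s x \<in> carrier B"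
  using rho_antihom
  by (auto simp: nonunital_antihom_def left_module_End_def end_ring_on_def additive_end_def Pi_iff PiE_iff)

lemma lam_add: "\<lbrakk>s \<in> carrier S; x \<in> carrier B; y \<in> carrier B\<rbrakk>
    \<Longrightarrow> lam s (x \<oplus>\<^bsub>B\<^esub> y) = lam s x \<oplus>\<^bsub>B\<^esub> lam s y"
  using lam_hom
  by (auto simp: nonunital_hom_def right_module_End_def end_ring_on_def additive_end_def Pi_iff)

lemma rho_add: "\<lbrakk>s \<in> carrier S; x \<in> carrier B; y \<in> carrier B\<rbrakk>
    \<Longrightarrow> rho s (x \<oplus>\<^bsub>B\<^esub> y) = rho s x \<oplus>\<^bsub>B\<^esub> rho s y"
  using rho_antihom
  by (auto simp: nonunital_antihom_def left_module_End_def end_ring_on_def additive_end_def Pi_iff)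

lemma lam_mult: "\<lbrakk>s \<in> carrier S; x \<in> carrier B; y \<in> carrier B\<rbrakk>
    \<Longrightarrow> lam s (x \<otimes>\<^bsub>B\<^esub> y) = lam s x \<otimes>\<^bsub>B\<^esub> y"
  using lam_hom by (auto simp: nonunital_hom_def right_module_End_def end_ring_on_def Pi_iff)

lemma rho_mult: "\<lbrakk>s \<in> carrier S; x \<in> carrier B; y \<in> carrier B\<rbrakk>
    \<Longrightarrow> rho s (x \<otimes>\<^bsub>B\<^esub> y) = x \<otimes>\<^bsub>B\<^esub> rho s y"
  using rho_antihom by (auto simp: nonunital_antihom_def left_module_End_def end_ring_on_def Pi_iff)

lemma lam_plus: "\<lbrakk>s \<in> carrier S; t \<in> carrier S; x \<in> carrier B\<rbrakk>
    \<Longrightarrow> lam (s \<oplus>\<^bsub>S\<^esub> t) x = lam s x \<oplus>\<^bsub>B\<^esub> lam t x"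
  using lam_hom by (auto simp: nonunital_hom_def right_module_End_def end_ring_on_def)

lemma rho_plus: "\<lbrakk>s \<in> carrier S; t \<in> carrier S; x \<in> carrier B\<rbrakk>
    \<Longrightarrow> rho (s \<oplus>\<^bsub>S\<^esub> t) x = rho s x \<oplus>\<^bsub>B\<^esub> rho t x"
  using rho_antihom by (auto simp: nonunital_antihom_def left_module_End_def end_ring_on_def)

lemma lam_comp: "\<lbrakk>s \<in> carrier S; t \<in> carrier S; x \<in> carrier B\<rbrakk>
    \<Longrightarrow> lam (s \<otimes>\<^bsub>S\<^esub> t) x = lam s (lam t x)"
  using lam_hom by (auto simp: nonunital_hom_def right_module_End_def end_ring_on_def compose_def)

lemma rho_comp: "\<lbrakk>s \<in> carrier S; t \<in> carrier S; x \<in> carrier B\<rbrakk>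
    \<Longrightarrow> rho (s \<otimes>\<^bsub>S\<^esub> t) x = rho t (rho s x)"
  using rho_antihom by (auto simp: nonunital_antihom_def left_module_End_def end_ring_on_def compose_def)

lemma lam_at_zero: "s \<in> carrier S \<Longrightarrow> lam s \<zero>\<^bsub>B\<^esub> = \<zero>\<^bsub>B\<^esub>"
  using lam_add[of s "\<zero>\<^bsub>B\<^esub>" "\<zero>\<^bsub>B\<^esub>"] lam_closed[of s "\<zero>\<^bsub>B\<^esub>"] by (simp add: B.add.l_cancel_one)

lemma rho_at_zero: "s \<in> carrier S \<Longrightarrow> rho s \<zero>\<^bsub>B\<^esub> = \<zero>\<^bsub>B\<^esub>"
  using rho_add[of s "\<zero>\<^bsub>B\<^esub>" "\<zero>\<^bsub>B\<^esub>"] rho_closed[of s "\<zero>\<^bsub>B\<^esub>"] by (simp add: B.add.l_cancel_one)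

lemma lam_zero: "x \<in> carrier B \<Longrightarrow> lam \<zero>\<^bsub>S\<^esub> x = \<zero>\<^bsub>B\<^esub>"
  using lam_plus[of "\<zero>\<^bsub>S\<^esub>" "\<zero>\<^bsub>S\<^esub>" x] lam_closed[of "\<zero>\<^bsub>S\<^esub>" x] by (simp add: B.add.l_cancel_one)

lemma rho_zero: "x \<in> carrier B \<Longrightarrow> rho \<zero>\<^bsub>S\<^esub> x = \<zero>\<^bsub>B\<^esub>"
  using rho_plus[of "\<zero>\<^bsub>S\<^esub>" "\<zero>\<^bsub>S\<^esub>" x] rho_closed[of "\<zero>\<^bsub>S\<^esub>" x] by (simp add: B.add.l_cancel_one)

lemma copy_of_B:
  fixes P defines "P \<equiv> semidirect_product B S lam rho"
  shows "(\<lambda>x. (x, \<zero>\<^bsub>S\<^esub>)) \<in> nonunital_hom B (P\<lparr>carrier := carrier B \<times> {\<zero>\<^bsub>S\<^esub>}\<rparr>)"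
    and "bij_betw (\<lambda>x. (x, \<zero>\<^bsub>S\<^esub>)) (carrier B) (carrier B \<times> {\<zero>\<^bsub>S\<^esub>})"
proof -
  show "(\<lambda>x. (x, \<zero>\<^bsub>S\<^esub>)) \<in> nonunital_hom B (P\<lparr>carrier := carrier B \<times> {\<zero>\<^bsub>S\<^esub>}\<rparr>)"
    by (auto simp: nonunital_hom_def P_def semidirect_product_def lam_zero rho_zero
        B.m_closed S.l_zero_mult)
  show "bij_betw (\<lambda>x. (x, \<zero>\<^bsub>S\<^esub>)) (carrier B) (carrier B \<times> {\<zero>\<^bsub>S\<^esub>})"
    by (auto simp: bij_betw_def inj_on_def)
qed

end

context unital_semidirect_data
begin

lemma lam_one_apply: "x \<in> carrier B \<Longrightarrow> lam \<one>\<^bsub>S\<^esub> x = x"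
  by (simp add: lam_one right_module_End_def end_ring_on_def)

lemma rho_one_apply: "x \<in> carrier B \<Longrightarrow> rho \<one>\<^bsub>S\<^esub> x = x"
  by (simp add: rho_one left_module_End_def end_ring_on_def)

lemma copy_of_S:
  fixes P defines "P \<equiv> semidirect_product B S lam rho"
  shows "(\<lambda>s. (\<zero>\<^bsub>B\<^esub>, s)) \<in> ring_iso S (P\<lparr>carrier := {\<zero>\<^bsub>B\<^esub>} \<times> carrier S\<rparr>)"
  by (auto simp: ring_iso_def ring_hom_def P_def semidirect_product_def lam_at_zero rho_at_zero
      B.r_zero_mult bij_betw_def inj_on_def)

lemma semidirect_product_is_ring: "ring (semidirect_product B S lam rho)" (is "ring ?P")
proof (rule ringI)
  show "abelian_group ?P"
  proof (rule abelian_groupI)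
    fix x assume "x \<in> carrier ?P"
    then obtain b s where x: "x = (b, s)" "b \<in> carrier B" "s \<in> carrier S"
      by (auto simp: semidirect_product_def)
    then show "\<exists>y \<in> carrier ?P. y \<oplus>\<^bsub>?P\<^esub> x = \<zero>\<^bsub>?P\<^esub>"
      by (intro bexI[of _ "(\<ominus>\<^bsub>B\<^esub> b, \<ominus>\<^bsub>S\<^esub> s)"])
        (auto simp: semidirect_product_def B.l_neg S.l_neg)
  qed (auto simp: semidirect_product_def B.a_ac S.a_ac)
  show "monoid ?P"
  proof (rule monoidI)
    fix x y z assume "x \<in> carrier ?P" "y \<in> carrier ?P" "z \<in> carrier ?P"
    then show "x \<otimes>\<^bsub>?P\<^esub> y \<otimes>\<^bsub>?P\<^esub> z = x \<otimes>\<^bsub>?P\<^esub> (y \<otimes>\<^bsub>?P\<^esub> z)"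
      by (auto simp: semidirect_product_def B.m_closed B.m_assoc S.m_assoc B.l_distr B.r_distr
          lam_closed rho_closed lam_add rho_add lam_mult rho_mult lam_comp rho_comp
          lam_rho_commute rho_lam_balanced B.a_ac)
  qed (auto simp: semidirect_product_def B.m_closed lam_closed rho_closed lam_one_apply
      rho_one_apply lam_at_zero rho_at_zero B.l_zero_mult B.r_zero_mult)
qed (auto simp: semidirect_product_def B.m_closed B.l_distr B.r_distr S.l_distr S.r_distr
    lam_closed rho_closed lam_add rho_add lam_plus rho_plus B.a_ac)

end

end

theory Submission
  imports Defs
begin

text \<open>Property (\<open>\<star>\<close>) says exactly that \<open>R\<close> is, as an additive group, the direct sum of an ideal
  and a subfield. Such an ideal is automatically maximal, since a strictly larger ideal contains a
  nonzero element of the subfield, hence a unit. Conversely, if the section \<open>j\<close> exhibits (\<open>\<star>\<close>), then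
  \<open>x - j(\<mm> + x)\<close> lies in \<open>\<mm>\<close>. Both the semidirect product and the property (\<open>\<star>\<close>) are read off
  from the direct sum decomposition.\<close>

section \<open>Multiplication by a subring on an ideal\<close>

lemma (in ideal) ideal_is_nonunital_ring: "nonunital_ring (R\<lparr>carrier := I\<rparr>)"
proof (intro nonunital_ring.intro nonunital_ring_axioms.intro)
  show "abelian_group (R\<lparr>carrier := I\<rparr>)"
  proof (rule abelian_groupI)
    fix x assume "x \<in> carrier (R\<lparr>carrier := I\<rparr>)"
    then show "\<exists>y \<in> carrier (R\<lparr>carrier := I\<rparr>). y \<oplus>\<^bsub>R\<lparr>carrier := I\<rparr>\<^esub> x = \<zero>\<^bsub>R\<lparr>carrier := I\<rparr>\<^esub>"
      using a_Hcarr by (intro bexI[of _ "\<ominus> x"]) (auto simp: l_neg)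
  qed (use a_Hcarr in \<open>auto simp: a_ac\<close>)
qed (use a_Hcarr in \<open>auto simp: I_l_closed m_assoc l_distr r_distr\<close>)

lemma (in ring) ring_is_nonunital_ring: "nonunital_ring R"
  by (intro nonunital_ring.intro nonunital_ring_axioms.intro)
    (auto simp: is_abelian_group m_assoc l_distr r_distr)

text \<open>Every compatibility condition is an instance of associativity or distributivity in
  \<open>R\<close>: commutation of \<open>lam\<close> and \<open>rho\<close> is u(xv) = (ux)v, and
  balance is (xu)y = x(uy). Absorption by the ideal keeps all the products in
  \<open>I\<close>.\<close>

lemma (in ideal) unital_semidirect_data_mult:
  assumes "subring K R"
  shows "unital_semidirect_data (R\<lparr>carrier := I\<rparr>) (R\<lparr>carrier := K\<rparr>) (left_mult R I) (right_mult R I)"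
proof -
  note K = subringE[OF assms]
  have Kc: "\<And>u. u \<in> K \<Longrightarrow> u \<in> carrier R" using K(1) by blast
  have ringK: "ring (R\<lparr>carrier := K\<rparr>)"
    by (rule subring_is_ring[OF assms])
  show ?thesis
  proof (intro unital_semidirect_data.intro semidirect_data.intro semidirect_data_axioms.intro
      unital_semidirect_data_axioms.intro)
    show "left_mult R I \<in> nonunital_hom (R\<lparr>carrier := K\<rparr>) (right_module_End (R\<lparr>carrier := I\<rparr>))"
      using Kc a_Hcarr
      by (auto simp: nonunital_hom_def right_module_End_def end_ring_on_def additive_end_def
          left_mult_def compose_def I_l_closed I_r_closed l_distr r_distr m_assoc fun_eq_iff)
    show "right_mult R I \<in> nonunital_antihom (R\<lparr>carrier := K\<rparr>) (left_module_End (R\<lparr>carrier := I\<rparr>))"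
      using Kc a_Hcarr
      by (auto simp: nonunital_antihom_def left_module_End_def end_ring_on_def additive_end_def
          right_mult_def compose_def I_l_closed I_r_closed l_distr r_distr m_assoc fun_eq_iff)
  qed (use Kc a_Hcarr in \<open>auto simp: ideal_is_nonunital_ring ring.ring_is_nonunital_ring[OF ringK]
      ringK left_mult_def right_mult_def I_l_closed I_r_closed m_assoc right_module_End_def
      left_module_End_def end_ring_on_def fun_eq_iff\<close>)
qed

lemma (in ideal) coset_eq_iff:
  assumes "x \<in> carrier R" "y \<in> carrier R"
  shows "I +> x = I +> y \<longleftrightarrow> x \<ominus> y \<in> I"
proof -
  have "I +> x = I +> y \<longleftrightarrow> x \<in> I +> y"
    using a_repr_independence'[of x y] a_repr_independenceD[of x y] assms by auto
  then show ?thesis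
    using a_rcos_module_minus[OF ring_axioms] assms by simp
qed

section \<open>Ideals complemented by a subfield\<close>

text \<open>Maximality of the ideal and uniqueness of the decomposition are derived below, so an
  instance has to supply only the existence of a decomposition and the trivial intersection.\<close>

locale complemented_ideal = ideal +
  fixes K
  assumes subfield: "subfield K R"
    and inter: "I \<inter> K \<subseteq> {\<zero>}"
    and decomp: "x \<in> carrier R \<Longrightarrow> \<exists>a \<in> I. \<exists>u \<in> K. x = a \<oplus> u"
begin

lemma sub_carrier: "u \<in> K \<Longrightarrow> u \<in> carrier R"
  using subfieldE(3)[OF subfield] by blast

lemma unique_sub:
  assumes "u \<in> K" "v \<in> K" "u \<ominus> v \<in> I"
  shows "u = v"
proof -
  note K = subringE[OF subfieldE(1)[OF subfield]]
  have "u \<ominus> v \<in> K"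
    using assms K unfolding a_minus_def by blast
  then have "u \<ominus> v = \<zero>"
    using assms inter by blast
  then show ?thesis
    using assms sub_carrier r_right_minus_eq by blast
qed

lemma unique_decomp:
  assumes "a \<in> I" "b \<in> I" "u \<in> K" "v \<in> K" "a \<oplus> u = b \<oplus> v"
  shows "a = b" "u = v"
proof -
  have c: "a \<in> carrier R" "b \<in> carrier R" "u \<in> carrier R" "v \<in> carrier R"
    using assms sub_carrier a_Hcarr by auto
  have "u = (a \<oplus> u) \<ominus> a"
    using c by algebra
  \<comment> \<open>Collecting the ideal parts on one side puts u - v into \<open>I\<close>, so that
    \<open>unique_sub\<close> applies.\<close>
  then have "u \<ominus> v = b \<ominus> a"
    using c unfolding assms(5) by algebra
  moreover have "b \<ominus> a \<in> I"
    using assms by (simp add: a_minus_def)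
  ultimately show "u = v"
    using assms unique_sub by simp
  then show "a = b"
    using assms(5) c by simp
qed

text \<open>Restricted to \<open>K\<close>, the projection is injective by
  \<open>unique_sub\<close>, and surjective because the coset of a + u is already the coset of
  u.\<close>

lemma rcos_iso: "(+>) I \<in> ring_iso (R\<lparr>carrier := K\<rparr>) (R Quot I)"
proof -
  have hom: "(+>) I \<in> ring_hom (R\<lparr>carrier := K\<rparr>) (R Quot I)"
    using rcos_ring_hom sub_carrier by (auto simp: ring_hom_def)
  have "inj_on ((+>) I) K"
    using coset_eq_iff sub_carrier unique_sub by (auto simp: inj_on_def)
  moreover have "X \<in> (+>) I ` K" if X: "X \<in> carrier (R Quot I)" for X
  proof -
    obtain x where x: "x \<in> carrier R" "X = I +> x"
      using X by (auto simp: FactRing_simps)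
    then obtain a u where au: "a \<in> I" "u \<in> K" "x = a \<oplus> u"
      using decomp by blast
    have "a \<in> carrier R" "u \<in> carrier R"
      using au sub_carrier a_Hcarr by auto
    then have "x \<ominus> u = a"
      unfolding au(3) by algebra
    then have "X = I +> u"
      using x au coset_eq_iff sub_carrier by simp
    then show ?thesis
      using au by blast
  qed
  moreover have "(+>) I ` K \<subseteq> carrier (R Quot I)"
    using hom by (auto simp: ring_hom_def)
  ultimately show ?thesis
    using hom by (auto simp: ring_iso_def bij_betw_def)
qed

lemma maximalideal: "maximalideal I R"
proof (rule maximalidealI)
  show "ideal I R" by (rule is_ideal)
  note K = subringE[OF subfieldE(1)[OF subfield]]
  \<comment> \<open>Otherwise 1 would lie in both \<open>I\<close> and \<open>K\<close>, hence be 0,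
    which is impossible in a subfield.\<close>
  show "carrier R \<noteq> I"
    using inter K(3) subfieldE(6)[OF subfield] by auto
  fix J assume J: "ideal J R" "I \<subseteq> J" "J \<subseteq> carrier R"
  interpret J: ideal J R by fact
  show "J = I \<or> J = carrier R"
  proof (cases "J = I")
    case False
    then obtain x where x: "x \<in> J" "x \<notin> I" using J by blast
    then obtain a u where au: "a \<in> I" "u \<in> K" "x = a \<oplus> u"
      using decomp J by blast
    have c: "a \<in> carrier R" "u \<in> carrier R"
      using au sub_carrier a_Hcarr by auto
    \<comment> \<open>If u were 0, then x = a would lie in \<open>I\<close>.\<close>
    have "u \<noteq> \<zero>"
      using au x c by auto
    then have "inv u \<in> carrier R" "inv u \<otimes> u = \<one>"
      using subfield_m_inv[OF subfield, of u] au sub_carrier by auto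
    moreover have "u \<in> J"
    proof -
      have "x \<ominus> a = u"
        using c unfolding au(3) by algebra
      then show ?thesis
        using x au J(2) J.a_closed J.a_inv_closed unfolding a_minus_def by (metis subsetD)
    qed
    ultimately have "\<one> \<in> J"
      using J.I_l_closed by metis
    then show ?thesis
      using J.one_imp_carrier by simp
  qed simp
qed

lemma exhibits_star: "exhibits_star R I K"
proof -
  \<comment> \<open>The section picks from each coset its unique representative in
    \<open>K\<close>.\<close>
  let ?j = "inv_into K ((+>) I)"
  have ring: "ring (R\<lparr>carrier := K\<rparr>)"
    using subring_is_ring subfieldE(1) subfield by blast
  have iso: "?j \<in> ring_iso (R Quot I) (R\<lparr>carrier := K\<rparr>)"
    using ring_iso_set_sym[OF ring rcos_iso] by simp
  have "I +> ?j X = X" if "X \<in> carrier (R Quot I)" for X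
    using that rcos_iso f_inv_into_f[of X "(+>) I" K] by (simp add: ring_iso_def bij_betw_def)
  moreover have "?j \<in> ring_hom (R Quot I) R"
    using iso sub_carrier by (auto simp: ring_iso_def ring_hom_def)
  ultimately show ?thesis
    using iso maximalideal subfield by (auto simp: exhibits_star_def is_section_def)
qed

text \<open>The isomorphism is addition of the two components. Expanding (a + u)(b + v) gives ab +
  ub + av, the ideal component of the product of pairs, plus uv. The map is built from the pairs to
  \<open>R\<close> and inverted at the end, which avoids choosing decompositions.\<close>

lemma iso_semidirect_product:
  "R \<simeq> semidirect_product (R\<lparr>carrier := I\<rparr>) (R\<lparr>carrier := K\<rparr>) (left_mult R I) (right_mult R I)"
  (is "R \<simeq> ?P")
proof -
  let ?f = "\<lambda>(a, u). a \<oplus> u"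
  have ring: "ring ?P"
    using unital_semidirect_data.semidirect_product_is_ring unital_semidirect_data_mult
      subfieldE(1)[OF subfield] by blast
  have "?f \<in> ring_iso ?P R"
  proof (rule ring_iso_memI)
    show "bij_betw ?f (carrier ?P) (carrier R)"
      unfolding bij_betw_def
    proof
      show "inj_on ?f (carrier ?P)"
        using unique_decomp by (auto simp: semidirect_product_def inj_on_def)
      show "?f ` carrier ?P = carrier R"
        using decomp sub_carrier a_Hcarr by (force simp: semidirect_product_def)
    qed
    fix x y assume "x \<in> carrier ?P" "y \<in> carrier ?P"
    then obtain a u b v where xy: "x = (a, u)" "y = (b, v)"
        and I: "a \<in> I" "b \<in> I" and KK: "u \<in> K" "v \<in> K"
      by (auto simp: semidirect_product_def)
    have c: "a \<in> carrier R" "b \<in> carrier R" "u \<in> carrier R" "v \<in> carrier R"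
      using I KK sub_carrier a_Hcarr by auto
    show "?f (x \<otimes>\<^bsub>?P\<^esub> y) = ?f x \<otimes> ?f y"
      using c I KK
      by (simp add: xy semidirect_product_def left_mult_def right_mult_def l_distr r_distr a_ac)
    show "?f (x \<oplus>\<^bsub>?P\<^esub> y) = ?f x \<oplus> ?f y"
      using c by (simp add: xy semidirect_product_def a_ac)
  qed (use sub_carrier a_Hcarr in \<open>auto simp: semidirect_product_def\<close>)
  then show ?thesis
    using ring_iso_sym[OF ring] by (auto simp: is_ring_iso_def)
qed

end

lemma exhibits_star_imp_complemented:
  fixes R (structure)
  assumes "exhibits_star R \<mm> \<kappa>"
  shows "complemented_ideal \<mm> R \<kappa>"
proof -
  interpret maximalideal \<mm> R
    using assms by (simp add: exhibits_star_def)
  interpret Q: ring "R Quot \<mm>"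
    by (rule quotient_is_ring)
  have sub: "subfield \<kappa> R"
    using assms by (simp add: exhibits_star_def)
  obtain j where j: "j \<in> ring_iso (R Quot \<mm>) (R\<lparr>carrier := \<kappa>\<rparr>)" "is_section R \<mm> j"
    using assms by (auto simp: exhibits_star_def)
  interpret j: ring_hom_ring "R Quot \<mm>" R j
    using j(2) by (intro ring_hom_ringI2) (auto simp: is_section_def Q.ring_axioms ring_axioms)
  have sec: "\<mm> +> j X = X" if "X \<in> carrier (R Quot \<mm>)" for X
    using j(2) that by (simp add: is_section_def)
  have bij: "j ` carrier (R Quot \<mm>) = \<kappa>"
    using j(1) by (simp add: ring_iso_def bij_betw_def)
  show ?thesis
  proof (intro complemented_ideal.intro complemented_ideal_axioms.intro is_ideal sub)
    show "\<mm> \<inter> \<kappa> \<subseteq> {\<zero>}"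
    proof
      fix u assume u: "u \<in> \<mm> \<inter> \<kappa>"
      then obtain X where X: "X \<in> carrier (R Quot \<mm>)" "u = j X"
        using bij by auto
      \<comment> \<open>The section property makes X the coset of u, which is trivial because u lies
        in the ideal; hence u = j(0) = 0.\<close>
      then have "X = \<zero>\<^bsub>R Quot \<mm>\<^esub>"
        using sec[of X] u a_rcos_const[of u] by (simp add: FactRing_def)
      then show "u \<in> {\<zero>}"
        using X j.hom_zero by simp
    qed
    fix x assume x: "x \<in> carrier R"
    let ?u = "j (\<mm> +> x)"
    have X: "\<mm> +> x \<in> carrier (R Quot \<mm>)"
      using x ring_hom_closed[OF rcos_ring_hom] by blast
    then have u: "?u \<in> \<kappa>"
      using bij by blast
    then have uc: "?u \<in> carrier R"
      using subfieldE(3)[OF sub] by blast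
    have "x \<ominus> ?u \<in> \<mm>"
      using sec[OF X] x uc a_rcos_module_minus[OF ring_axioms] a_rcos_self by metis
    moreover have "x = (x \<ominus> ?u) \<oplus> ?u"
      using x uc by algebra
    ultimately show "\<exists>a \<in> \<mm>. \<exists>u \<in> \<kappa>. x = a \<oplus> u"
      using u by blast
  qed
qed

section \<open>Property (\<open>\<star>\<close>) in terms of complemented ideals\<close>

lemma exhibits_star_imp_property_star:
  "exhibits_star R \<mm> \<kappa> \<Longrightarrow> property_star R"
  unfolding exhibits_star_def property_star_def is_ring_iso_def by blast

text \<open>In \<open>property_star\<close> the section s and the subfield \<kappa> are unrelated:
  \<kappa> is only abstractly isomorphic to the quotient. The complement is therefore the image of
  s, and \<kappa> serves to show that this image is a subfield.\<close>

lemma property_star_imp_complemented: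
  fixes R (structure)
  assumes "property_star R"
  obtains \<mm> \<kappa> where "complemented_ideal \<mm> R \<kappa>"
proof -
  obtain \<mm> s \<kappa> where max: "maximalideal \<mm> R" and s: "is_section R \<mm> s"
    and \<kappa>: "subfield \<kappa> R" and iso: "R Quot \<mm> \<simeq> R\<lparr>carrier := \<kappa>\<rparr>"
    using assms by (auto simp: property_star_def)
  interpret maximalideal \<mm> R by (rule max)
  interpret Q: ring "R Quot \<mm>"
    by (rule quotient_is_ring)
  interpret F: field "R\<lparr>carrier := \<kappa>\<rparr>"
    by (rule subfield_iff(2)[OF \<kappa>])
  obtain h where h: "h \<in> ring_iso (R\<lparr>carrier := \<kappa>\<rparr>) (R Quot \<mm>)"
    using ring_iso_sym[OF Q.ring_axioms iso] by (auto simp: is_ring_iso_def)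
  have s_hom: "s \<in> ring_hom (R Quot \<mm>) R"
    using s by (simp add: is_section_def)
  \<comment> \<open>Precomposing with h presents the image of s as the image of a field in a nonzero
    ring.\<close>
  have "ring_hom_ring (R\<lparr>carrier := \<kappa>\<rparr>) R (s \<circ> h)"
    using h s_hom ring_hom_trans
    by (intro ring_hom_ringI2) (auto simp: ring_iso_def F.ring_axioms ring_axioms)
  moreover have "\<one> \<noteq> \<zero>"
    using subfieldE(6)[OF \<kappa>] .
  ultimately have "subfield ((s \<circ> h) ` \<kappa>) R"
    using ring_hom_ring.img_is_subfield(2)[OF _ F.carrier_is_subfield] by fastforce
  moreover have "h ` \<kappa> = carrier (R Quot \<mm>)"
    using h by (simp add: ring_iso_def bij_betw_def)
  ultimately have sub: "subfield (s ` carrier (R Quot \<mm>)) R"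
    by (metis image_comp)
  \<comment> \<open>The coset of s X is X, so s X determines X.\<close>
  have "inj_on s (carrier (R Quot \<mm>))"
    using s by (metis inj_onI is_section_def)
  then have "s \<in> ring_iso (R Quot \<mm>) (R\<lparr>carrier := s ` carrier (R Quot \<mm>)\<rparr>)"
    using s_hom by (auto simp: ring_iso_def bij_betw_def ring_hom_def)
  then have "exhibits_star R \<mm> (s ` carrier (R Quot \<mm>))"
    using max sub s by (auto simp: exhibits_star_def)
  then show thesis
    using that exhibits_star_imp_complemented by blast
qed

lemma property_star_iff_complemented:
  "property_star R \<longleftrightarrow> (\<exists>\<mm> \<kappa>. complemented_ideal \<mm> R \<kappa>)"
  using property_star_imp_complemented complemented_ideal.exhibits_star
    exhibits_star_imp_property_star by metis

text \<open>A complemented ideal is transported instead of a section, so no isomorphism of quotients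
  has to be built: the ideal is pulled back along h and the subfield pushed forward along its
  inverse g.\<close>

lemma property_star_iso:
  assumes "ring R" "ring P" "R \<simeq> P" "property_star P"
  shows "property_star R"
proof -
  obtain \<mm> \<kappa> where "complemented_ideal \<mm> P \<kappa>"
    using assms(4) property_star_imp_complemented by blast
  then interpret P: complemented_ideal \<mm> P \<kappa> .
  obtain h where h: "h \<in> ring_iso R P"
    using assms(3) by (auto simp: is_ring_iso_def)
  define g where "g = inv_into (carrier R) h"
  have g: "g \<in> ring_iso P R"
    unfolding g_def by (rule ring_iso_set_sym[OF assms(1) h])
  interpret h: ring_hom_ring R P h
    using h assms by (intro ring_hom_ringI2) (auto simp: ring_iso_def)
  interpret g: ring_hom_ring P R g
    using g assms by (intro ring_hom_ringI2) (auto simp: ring_iso_def)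
  have hg: "h (g y) = y" if "y \<in> carrier P" for y
    using h that by (auto simp: g_def ring_iso_def bij_betw_def intro: f_inv_into_f)
  have gh: "g (h x) = x" if "x \<in> carrier R" for x
    using h that by (auto simp: g_def ring_iso_def bij_betw_def)
  \<comment> \<open>If 1 = 0 held in \<open>R\<close>, then h would carry this equation to
    \<open>P\<close>, which contains a subfield.\<close>
  have one: "\<one>\<^bsub>R\<^esub> \<noteq> \<zero>\<^bsub>R\<^esub>"
    using subfieldE(6)[OF P.subfield] h.hom_one h.hom_zero by metis
  have "complemented_ideal {r \<in> carrier R. h r \<in> \<mm>} R (g ` \<kappa>)"
  proof (intro complemented_ideal.intro complemented_ideal_axioms.intro)
    show "ideal {r \<in> carrier R. h r \<in> \<mm>} R"
      by (rule h.ideal_vimage[OF P.is_ideal])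
    show "subfield (g ` \<kappa>) R"
      by (rule g.img_is_subfield(2)[OF P.subfield one])
    show "{r \<in> carrier R. h r \<in> \<mm>} \<inter> g ` \<kappa> \<subseteq> {\<zero>\<^bsub>R\<^esub>}"
      using P.inter hg P.sub_carrier g.hom_zero by auto
    fix x assume x: "x \<in> carrier R"
    then obtain a u where au: "a \<in> \<mm>" "u \<in> \<kappa>" "h x = a \<oplus>\<^bsub>P\<^esub> u"
      using P.decomp h.hom_closed by blast
    then have c: "a \<in> carrier P" "u \<in> carrier P"
      using P.a_Hcarr P.sub_carrier by auto
    have "x = g a \<oplus>\<^bsub>R\<^esub> g u"
      using gh[OF x] au c by simp
    moreover have "g a \<in> {r \<in> carrier R. h r \<in> \<mm>}"
      using au c hg by simp
    ultimately show "\<exists>a \<in> {r \<in> carrier R. h r \<in> \<mm>}. \<exists>u \<in> g ` \<kappa>. x = a \<oplus>\<^bsub>R\<^esub> u"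
      using au by blast
  qed
  then show ?thesis
    using property_star_iff_complemented by blast
qed

section \<open>Semidirect products over a field\<close>

text \<open>The ideal is obtained as the kernel of the second projection and the subfield as the
  image of the embedding of \<open>S\<close>, so the axioms of either need no direct check.\<close>

lemma (in unital_semidirect_data) complemented_ideal_semidirect_product:
  assumes "field S"
  shows "complemented_ideal (carrier B \<times> {\<zero>\<^bsub>S\<^esub>}) (semidirect_product B S lam rho)
    ({\<zero>\<^bsub>B\<^esub>} \<times> carrier S)" (is "complemented_ideal ?M ?P ?K")
proof -
  interpret P: ring ?P by (rule semidirect_product_is_ring)
  interpret F: field S by fact
  have "ring_hom_ring S ?P (\<lambda>s. (\<zero>\<^bsub>B\<^esub>, s))"
    by (intro ring_hom_ringI2 S.ring_axioms P.ring_axioms ring_hom_memI)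
      (auto simp: semidirect_product_def lam_at_zero rho_at_zero B.r_zero_mult)
  moreover have "\<one>\<^bsub>?P\<^esub> \<noteq> \<zero>\<^bsub>?P\<^esub>"
    by (simp add: semidirect_product_def)
  ultimately have "subfield ((\<lambda>s. (\<zero>\<^bsub>B\<^esub>, s)) ` carrier S) ?P"
    using ring_hom_ring.img_is_subfield(2) F.carrier_is_subfield by blast
  moreover have "(\<lambda>s. (\<zero>\<^bsub>B\<^esub>, s)) ` carrier S = ?K"
    by auto
  ultimately have sub: "subfield ?K ?P"
    by simp
  have "ring_hom_ring ?P S snd"
    by (intro ring_hom_ringI2 S.ring_axioms P.ring_axioms ring_hom_memI)
      (auto simp: semidirect_product_def)
  then have "ideal (a_kernel ?P S snd) ?P"
    by (rule ring_hom_ring.kernel_is_ideal)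
  moreover have "a_kernel ?P S snd = ?M"
    by (auto simp: a_kernel_def' semidirect_product_def)
  ultimately have ideal: "ideal ?M ?P"
    by simp
  have "\<exists>a \<in> ?M. \<exists>u \<in> ?K. x = a \<oplus>\<^bsub>?P\<^esub> u" if "x \<in> carrier ?P" for x
    using that
    by (intro bexI[of _ "(fst x, \<zero>\<^bsub>S\<^esub>)"] bexI[of _ "(\<zero>\<^bsub>B\<^esub>, snd x)"])
      (auto simp: semidirect_product_def)
  then show ?thesis
    using ideal sub
    by (intro complemented_ideal.intro complemented_ideal_axioms.intro)
      (auto simp: semidirect_product_def)
qed

lemma (in unital_semidirect_data) property_star_semidirect_product:
  assumes "field S" "ring R" "R \<simeq> semidirect_product B S lam rho"
  shows "property_star R"
  using assms complemented_ideal_semidirect_product property_star_iff_complemented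
    property_star_iso semidirect_product_is_ring by metis

text \<open>The theorem asks for records of type \<open>'r ring\<close>, so the extra fields of \<open>R\<close> must be dropped.\<close>

lemma (in ring) ring_truncate: "ring (ring.truncate R)" "R \<simeq> ring.truncate R" "ring.truncate R \<simeq> R"
proof -
  have id: "id \<in> ring_iso R (ring.truncate R)"
    by (rule ring_iso_memI) (auto simp: ring.truncate_def)
  then show "R \<simeq> ring.truncate R"
    by (auto simp: is_ring_iso_def)
  then show "ring.truncate R \<simeq> R"
    by (rule ring_iso_sym[OF ring_axioms])
  show "ring (ring.truncate R)"
    using ring_iso_imp_img_ring[OF id] by (simp add: ring.truncate_def)
qed

theorem theorem3p2:
  fixes R :: "('r, 'm) ring_scheme"
    and B :: "('b, 'p) ring_scheme" and K :: "('k, 'q) ring_scheme"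
    and lam rho :: "'k \<Rightarrow> 'b \<Rightarrow> 'b"
  assumes "ring R"
  shows
    "(field K \<and> unital_semidirect_data B K lam rho \<longrightarrow>
        (let P = semidirect_product B K lam rho;
             \<mm> = carrier B \<times> {\<zero>\<^bsub>K\<^esub>};
             \<kappa> = {\<zero>\<^bsub>B\<^esub>} \<times> carrier K
         in maximalideal \<mm> P \<and> subfield \<kappa> P \<and>
            (\<exists>j \<in> ring_iso (P Quot \<mm>) (P\<lparr>carrier := \<kappa>\<rparr>). is_section P \<mm> j) \<and>
            property_star P))
     \<and> (\<forall>\<mm> \<kappa>. exhibits_star R \<mm> \<kappa> \<longrightarrow>
          unital_semidirect_data (R\<lparr>carrier := \<mm>\<rparr>) (R\<lparr>carrier := \<kappa>\<rparr>)
            (left_mult R \<mm>) (right_mult R \<mm>) \<and>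
          R \<simeq> semidirect_product (R\<lparr>carrier := \<mm>\<rparr>) (R\<lparr>carrier := \<kappa>\<rparr>)
                (left_mult R \<mm>) (right_mult R \<mm>))
     \<and> (field K \<and> unital_semidirect_data B K lam rho \<and> R \<simeq> semidirect_product B K lam rho
          \<longrightarrow> property_star R)
     \<and> (property_star R \<longleftrightarrow>
          (\<exists>(B' :: 'r ring) (K' :: 'r ring) lam' rho'.
             field K' \<and> unital_semidirect_data B' K' lam' rho' \<and>
             R \<simeq> semidirect_product B' K' lam' rho'))
     \<and> (property_star R \<longleftrightarrow>
          (\<exists>\<mm> \<kappa>. ideal \<mm> R \<and> subfield \<kappa> R \<and>
             R \<simeq> semidirect_product (R\<lparr>carrier := \<mm>\<rparr>) (R\<lparr>carrier := \<kappa>\<rparr>)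
                   (left_mult R \<mm>) (right_mult R \<mm>)))"
proof -
  interpret ring R by fact
  have "\<exists>(B' :: 'r ring) (K' :: 'r ring) lam' rho'. field K' \<and>
      unital_semidirect_data B' K' lam' rho' \<and> R \<simeq> semidirect_product B' K' lam' rho'"
    if "property_star R"
  proof -
    have "property_star (ring.truncate R)"
      using property_star_iso[OF ring_truncate(1) ring_axioms ring_truncate(3) that] .
    then obtain \<mm> \<kappa> where "complemented_ideal \<mm> (ring.truncate R) \<kappa>"
      using property_star_imp_complemented by blast
    then interpret C: complemented_ideal \<mm> "ring.truncate R" \<kappa> .
    show ?thesis
      using C.subfield_iff(2)[OF C.subfield]
        C.unital_semidirect_data_mult[OF subfieldE(1)[OF C.subfield]]
        ring_iso_trans[OF ring_truncate(2) C.iso_semidirect_product]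
      by blast
  qed
  moreover have "\<exists>\<mm> \<kappa>. ideal \<mm> R \<and> subfield \<kappa> R \<and>
      R \<simeq> semidirect_product (R\<lparr>carrier := \<mm>\<rparr>) (R\<lparr>carrier := \<kappa>\<rparr>)
        (left_mult R \<mm>) (right_mult R \<mm>)"
    if "property_star R"
    using property_star_imp_complemented[OF that] complemented_ideal.iso_semidirect_product
      complemented_ideal.subfield complemented_ideal.axioms(1) by metis
  \<comment> \<open>The isomorphism is abstract, so \<mm> and \<kappa> need not be complementary
    inside \<open>R\<close>. The property is instead transported from the semidirect product, whose
    canonical copies of the factors are complementary.\<close>
  moreover have "property_star R"
    if "ideal \<mm> R" "subfield \<kappa> R" "R \<simeq> semidirect_product (R\<lparr>carrier := \<mm>\<rparr>)
      (R\<lparr>carrier := \<kappa>\<rparr>) (left_mult R \<mm>) (right_mult R \<mm>)" for \<mm> \<kappa>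
    using that unital_semidirect_data.property_star_semidirect_product
      ideal.unital_semidirect_data_mult subfieldE(1) subfield_iff(2) ring_axioms by metis
  moreover have "unital_semidirect_data (R\<lparr>carrier := \<mm>\<rparr>) (R\<lparr>carrier := \<kappa>\<rparr>)
        (left_mult R \<mm>) (right_mult R \<mm>) \<and>
      R \<simeq> semidirect_product (R\<lparr>carrier := \<mm>\<rparr>) (R\<lparr>carrier := \<kappa>\<rparr>)
        (left_mult R \<mm>) (right_mult R \<mm>)" if "exhibits_star R \<mm> \<kappa>" for \<mm> \<kappa>
  proof -
    interpret C: complemented_ideal \<mm> R \<kappa>
      by (rule exhibits_star_imp_complemented[OF that])
    show ?thesis
      using C.unital_semidirect_data_mult[OF subfieldE(1)[OF C.subfield]]
        C.iso_semidirect_product by blast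
  qed
  moreover have "let P = semidirect_product B K lam rho;
        \<mm> = carrier B \<times> {\<zero>\<^bsub>K\<^esub>};
        \<kappa> = {\<zero>\<^bsub>B\<^esub>} \<times> carrier K
      in maximalideal \<mm> P \<and> subfield \<kappa> P \<and>
        (\<exists>j \<in> ring_iso (P Quot \<mm>) (P\<lparr>carrier := \<kappa>\<rparr>). is_section P \<mm> j) \<and>
        property_star P"
    if "field K" "unital_semidirect_data B K lam rho"
  proof -
    \<comment> \<open>Unfolding \<open>exhibits_star\<close> yields the maximal ideal, the subfield
      and the section for the canonical copies all at once.\<close>
    have "exhibits_star (semidirect_product B K lam rho)
        (carrier B \<times> {\<zero>\<^bsub>K\<^esub>}) ({\<zero>\<^bsub>B\<^esub>} \<times> carrier K)"
      by (rule complemented_ideal.exhibits_star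
          [OF unital_semidirect_data.complemented_ideal_semidirect_product[OF that(2,1)]])
    then show ?thesis
      using exhibits_star_imp_property_star unfolding Let_def exhibits_star_def by blast
  qed
  moreover have "property_star R"
    if "field K'" "unital_semidirect_data B' K' lam' rho'" "R \<simeq> semidirect_product B' K' lam' rho'"
    for B' :: "'r ring" and K' :: "'r ring" and lam' rho'
    using unital_semidirect_data.property_star_semidirect_product[OF that(2,1) ring_axioms that(3)] .
  moreover have "property_star R"
    if "field K" "unital_semidirect_data B K lam rho" "R \<simeq> semidirect_product B K lam rho"
    using unital_semidirect_data.property_star_semidirect_product[OF that(2,1) ring_axioms that(3)] .
  ultimately show ?thesis
    by (intro conjI) blast+
qed

end
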